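(* Let $D\subseteq\mathbb{R}^2$ be a bounded Borel set equipped with a finite diffuse Borel measure $\mu$ with $\mu(D)>0$, and let $M$ be a complete separable metric space equipped with a Borel probability measure $\mu_M$. Let $N^f=\bigcup_{n=0}^\infty (D\times M)^n$ be the space of finite sequences $\vec{y}=(y_1,\dots,y_n)$ of marked points $y_i\in D\times M$, and let $f:N^f\to[0,\infty)$ be a probability density with respect to the reference measure $\nu$ on $N^f$ given by $$\nu(F)=\sum_{n=0}^\infty \frac{e^{-\mu(D)}}{n!}\int_{D\times M}\cdots\int_{D\times M}\mathbf{1}\{(y_1,\dots,y_n)\in F\}\,d(\mu\times\mu_M)(y_1)\cdots d(\mu\times\mu_M)(y_n).$$ Let $\sim$ be a reflexive (not necessarily symmetric) relation on $D\times M$. Then the sequential spatial process with density $f$ is Markov with respect to $\sim$ (in the sense defined in the context) if and only if there exists a non-negative, jointly measurable function $\varphi:(D\times M)\times\widetilde{N}^f\to[0,\infty)$ such that $\varphi(u,\mathbf{z})=1$ whenever $\mathbf{z}$ is not a $u$-clique, and such that for every $n\ge 0$ and every $(y_1,\dots,y_n)\in(D\times M)^n$, $$f(y_1,\dots,y_n)=f(\emptyset)\prod_{i=1}^n\prod_{\mathbf{z}\subseteq\mathbf{y}_{<i}}\varphi(y_i,\mathbf{z}),$$ where $\mathbf{y}_{<i}=\{y_1,\dots,y_{i-1}\}$ and the inner product ranges over all subsets $\mathbf{z}$ of $\mathbf{y}_{<i}$ (including the empty set).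
   Context: $\widetilde{N}^f$ denotes the family of finite unordered configurations (finite sets) of marked points in $D\times M$; a sequence is identified with the set of its components when permutation-invariance applies. $\emptyset$ denotes the empty sequence. A subsequence of $\vec{y}$ is a sequence obtained from $\vec{y}$ by deleting some of its components while keeping the order of the rest. For $u\in D\times M$, $(\vec{y},u)=(y_1,\dots,y_n,u)$ denotes appending $u$ at the end. If $u\sim y$, the marked point $y$ is called a directed neighbour of $u$. The density $f$ is called Markov with respect to $\sim$ if (i) $f(\vec{y})>0$ implies $f(\vec{z})>0$ for all subsequences $\vec{z}$ of $\vec{y}$, and (ii) for all $\vec{y}$ with $f(\vec{y})>0$ and all $u\in D\times M$, the ratio $f((\vec{y},u))/f(\vec{y})$ depends only on $u$ and on the set of its directed neighbours $\{y_i\in\vec{y}: u\sim y_i\}$ in $\vec{y}$. For $u\in D\times M$, a finite configuration $\mathbf{z}$ is a $u$-clique with respect to $\sim$ if either $\mathbf{z}=\emptyset$ or $u\sim z$ for every $z\in\mathbf{z}$. *)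

theory Defs
  imports "HOL-Probability.Probability" "HOL-Library.Sublist"
begin

definition markP :: "(real^2) measure \<Rightarrow> 'm measure \<Rightarrow> (real^2) set \<Rightarrow> ((real^2) \<times> 'm) measure" where
  "markP mu muM D = restrict_space (mu \<Otimes>\<^sub>M muM) (D \<times> space muM)"

definition powP :: "'p measure \<Rightarrow> nat \<Rightarrow> (nat \<Rightarrow> 'p) measure" where
  "powP P n = PiM {..<n} (\<lambda>_. P)"

text \<open>The space N^f of finite sequences of marked points, with the natural
(disjoint-union) sigma-algebra: F is measurable iff its n-th slice is measurable in P^n.\<close>
definition list_sets :: "'p measure \<Rightarrow> 'p list set set" where
  "list_sets P = {F. F \<subseteq> {ys. set ys \<subseteq> space P} \<and>
      (\<forall>n. {x \<in> space (powP P n). map x [0..<n] \<in> F} \<in> sets (powP P n))}"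

definition ref_measure :: "(real^2) measure \<Rightarrow> 'm measure \<Rightarrow> (real^2) set \<Rightarrow> ((real^2) \<times> 'm) list measure" where
  "ref_measure mu muM D = measure_of {ys. set ys \<subseteq> space (markP mu muM D)}
      (list_sets (markP mu muM D))
      (\<lambda>F. \<Sum>n. ennreal (exp (- measure mu D) / fact n) *
              emeasure (powP (markP mu muM D) n)
                {x \<in> space (powP (markP mu muM D) n). map x [0..<n] \<in> F})"

text \<open>The space of finite unordered configurations (finite subsets of the space of P), with
the sigma-algebra induced from N^f via the map (y_1,...,y_n) to {y_1,...,y_n}.\<close>
definition config_sets :: "'p measure \<Rightarrow> 'p set set set" where
  "config_sets P = {A. A \<subseteq> {Z. finite Z \<and> Z \<subseteq> space P} \<and>
      (\<forall>n. {x \<in> space (powP P n). x ` {..<n} \<in> A} \<in> sets (powP P n))}"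

definition configM :: "'p measure \<Rightarrow> 'p set measure" where
  "configM P = measure_of {Z. finite Z \<and> Z \<subseteq> space P} (config_sets P) (\<lambda>_. 0)"

definition u_clique :: "('p \<Rightarrow> 'p \<Rightarrow> bool) \<Rightarrow> 'p \<Rightarrow> 'p set \<Rightarrow> bool" where
  "u_clique R u Z \<longleftrightarrow> Z = {} \<or> (\<forall>z\<in>Z. R u z)"

definition markov :: "'p set \<Rightarrow> ('p \<Rightarrow> 'p \<Rightarrow> bool) \<Rightarrow> ('p list \<Rightarrow> real) \<Rightarrow> bool" where
  "markov S R f \<longleftrightarrow>
     (\<forall>ys zs. set ys \<subseteq> S \<longrightarrow> f ys > 0 \<longrightarrow> subseq zs ys \<longrightarrow> f zs > 0) \<and>
     (\<exists>g. \<forall>ys u. set ys \<subseteq> S \<longrightarrow> f ys > 0 \<longrightarrow> u \<in> S \<longrightarrow>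
          f (ys @ [u]) / f ys = g u {y \<in> set ys. R u y})"

end

theory Submission
  imports Defs "HOL-Combinatorics.Multiset_Permutations"
begin

text \<open>
  For a Markov density, \<open>f (zs @ [u]) / f zs\<close> is the same for every ordering \<open>zs\<close> of a
  configuration \<open>Z\<close> with \<open>f zs > 0\<close>, so it equals the quotient of the sums of \<open>f (zs @ [u])\<close> and
  \<open>f zs\<close> over all orderings. This expression for the conditional intensity does not mention the
  relation, which need not be measurable. Multiplicative Moebius inversion over the subsets of \<open>Z\<close>
  yields \<open>\<phi>\<close>; it is trivial off the cliques because the intensity only sees the neighbours of \<open>u\<close>,
  and where it would divide by zero \<open>\<phi>\<close> can be set to 1 because a vanishing intensity stays zero
  when the configuration grows.
\<close>

section \<open>Measurability on the space of finite configurations\<close>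

text \<open>Each point is encoded by the basis sets that contain it, written as digits 0 and 1 in
  base 3. In this base the first differing digit outweighs all later ones together, so distinct
  points get distinct values. The function becomes the sorting key for configurations.\<close>

lemma ex_inj_borel_measurable_real:
  "\<exists>\<iota> :: 'a::{second_countable_topology, t2_space} \<Rightarrow> real. \<iota> \<in> borel_measurable borel \<and> inj \<iota>"
proof -
  obtain B :: "'a set set" where B: "countable B" "topological_basis B"
    using ex_countable_basis by blast
  \<comment> \<open>The added empty set keeps the enumerated set nonempty, so that
    \<open>from_nat_into\<close> has exactly this range.\<close>
  define E where "E = from_nat_into (insert {} B)"
  have range_E: "range E = insert {} B"
    unfolding E_def using B(1) by (intro range_from_nat_into) auto
  have open_E: "open (E n)" for n
  proof -
    have "E n \<in> insert {} B" using range_E by auto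
    then show ?thesis using topological_basis_open[OF B(2)] by auto
  qed
  define t where "t = (\<lambda>x n. (1/3::real) ^ n * indicator (E n) x)"
  define \<iota> where "\<iota> = (\<lambda>x. \<Sum>n. t x n)"
  have geo: "summable (\<lambda>n. (1/3::real) ^ n)" by (rule summable_geometric) simp
  have sm: "summable (t x)" for x
    by (rule summable_comparison_test[OF _ geo]) (auto simp: t_def indicator_def)
  have "\<iota> \<in> borel_measurable borel"
    unfolding \<iota>_def t_def using open_E
    by (intro borel_measurable_suminf borel_measurable_times borel_measurable_indicator) auto
  moreover have "inj \<iota>"
  proof (rule injI, rule ccontr)
    fix x y assume eq: "\<iota> x = \<iota> y" and "x \<noteq> y"
    then obtain U where "open U" "x \<in> U" "y \<notin> U" using separation_t1[of x y] t1_space by blast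
    then obtain V where "V \<in> B" "x \<in> V" "V \<subseteq> U"
      using topological_basisE[OF B(2)] by metis
    then obtain m where "x \<in> E m" "y \<notin> E m" using range_E \<open>y \<notin> U\<close>
      by (metis imageE insertI2 subsetD)
    then have ex: "\<exists>m. (x \<in> E m) \<noteq> (y \<in> E m)" by blast
    \<comment> \<open>At the first differing digit the difference has absolute value
      \<open>(1/3) ^ n\<close>, whereas all later terms add up to at most half of that.\<close>
    define n where "n = (LEAST m. (x \<in> E m) \<noteq> (y \<in> E m))"
    have n: "(x \<in> E n) \<noteq> (y \<in> E n)" unfolding n_def by (rule LeastI_ex[OF ex])
    have less: "(x \<in> E k) = (y \<in> E k)" if "k < n" for k
      using not_less_Least[of k "\<lambda>m. (x \<in> E m) \<noteq> (y \<in> E m)"] that unfolding n_def by blast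
    define d where "d = (\<lambda>k. t x k - t y k)"
    have sd: "summable d" unfolding d_def by (intro summable_diff sm)
    have "suminf d = 0" unfolding d_def using suminf_diff[OF sm[of x] sm[of y]] eq by (simp add: \<iota>_def)
    moreover have "suminf d = (\<Sum>k. d (k + Suc n)) + (\<Sum>k<Suc n. d k)"
      by (rule suminf_split_initial_segment[OF sd])
    moreover have "(\<Sum>k<n. d k) = 0" using less by (intro sum.neutral) (auto simp: d_def t_def indicator_def)
    ultimately have dn: "d n = - (\<Sum>k. d (k + Suc n))" by simp
    have gs: "summable (\<lambda>k. (1/3::real) ^ (k + Suc n))"
      using summable_ignore_initial_segment[OF geo] .
    have bd: "norm (d k) \<le> (1/3) ^ k" for k by (auto simp: d_def t_def indicator_def)
    have "norm (\<Sum>k. d (k + Suc n)) \<le> (\<Sum>k. (1/3) ^ (k + Suc n))"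
      by (rule norm_suminf_le[OF bd gs])
    also have "\<dots> = (1/3) ^ Suc n * (\<Sum>k. (1/3) ^ k)"
      using suminf_mult[OF geo, of "(1/3) ^ Suc n"] by (simp add: power_add mult.commute)
    also have "\<dots> = (1/3) ^ n / 2" by (subst suminf_geometric) auto
    finally have "\<bar>d n\<bar> \<le> (1/3) ^ n / 2" unfolding dn by simp
    moreover have "\<bar>d n\<bar> = (1/3) ^ n" using n by (auto simp: d_def t_def indicator_def)
    ultimately show False by simp
  qed
  ultimately show ?thesis by blast
qed

section \<open>Sorting finite configurations measurably\<close>

lemma space_configM: "space (configM P) = {Z. finite Z \<and> Z \<subseteq> space P}"
  unfolding configM_def by (rule space_measure_of) (auto simp: config_sets_def)

lemma config_sets_in_sets:
  assumes "A \<subseteq> {Z. finite Z \<and> Z \<subseteq> space P}"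
    and "\<And>n::nat. {x \<in> space (PiM {..<n} (\<lambda>_. P)). x ` {..<n} \<in> A} \<in> sets (PiM {..<n} (\<lambda>_. P))"
  shows "A \<in> sets (configM P)"
proof -
  have "A \<in> config_sets P" unfolding config_sets_def powP_def using assms by blast
  then show ?thesis unfolding configM_def
    by (subst sets_measure_of) (auto simp: config_sets_def)
qed

text \<open>The order is pulled back from the reals along \<iota>. Strict increase excludes
  repetitions, which makes the list unique when \<iota> is injective on \<open>Z\<close>.\<close>

definition sort_by :: "('p \<Rightarrow> real) \<Rightarrow> 'p set \<Rightarrow> 'p list" where
  "sort_by \<iota> Z = (THE zs. set zs = Z \<and> sorted_wrt (\<lambda>a b. \<iota> a < \<iota> b) zs)"

lemma sort_by_unique:
  fixes \<iota> :: "'p \<Rightarrow> real"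
  assumes inj: "inj_on \<iota> Z"
    and "set zs = Z" "sorted_wrt (\<lambda>a b. \<iota> a < \<iota> b) zs"
    and "set zs' = Z" "sorted_wrt (\<lambda>a b. \<iota> a < \<iota> b) zs'"
  shows "zs = zs'"
proof -
  have "map \<iota> zs = map \<iota> zs'"
    by (rule strict_sorted_equal) (use assms in \<open>auto simp: sorted_wrt_map\<close>)
  then show ?thesis using inj assms by (metis inj_on_map_eq_map Un_absorb)
qed

lemma sort_by_eqI:
  assumes "inj_on \<iota> Z" "set zs = Z" "sorted_wrt (\<lambda>a b. \<iota> a < \<iota> b) zs"
  shows "sort_by \<iota> Z = zs"
  unfolding sort_by_def
proof (rule the_equality)
  show "set zs = Z \<and> sorted_wrt (\<lambda>a b. \<iota> a < \<iota> b) zs" using assms by simp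
  fix zs' assume "set zs' = Z \<and> sorted_wrt (\<lambda>a b. \<iota> a < \<iota> b) zs'"
  then show "zs' = zs" using sort_by_unique[OF assms(1), of zs' zs] assms by simp
qed

text \<open>The finite set of keys is sorted in the reals and pulled back through the inverse of
  \<iota> on \<open>Z\<close>.\<close>

lemma sort_by:
  assumes "inj_on \<iota> Z" "finite Z"
  shows "set (sort_by \<iota> Z) = Z" "sorted_wrt (\<lambda>a b. \<iota> a < \<iota> b) (sort_by \<iota> Z)"
proof -
  define zs where "zs = map (the_inv_into Z \<iota>) (sorted_list_of_set (\<iota> ` Z))"
  have 1: "set zs = Z"
    unfolding zs_def using assms by (simp add: the_inv_into_onto)
  have "map \<iota> zs = sorted_list_of_set (\<iota> ` Z)"
    unfolding zs_def using assms by (auto intro!: map_idI simp: f_the_inv_into_f)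
  then have "sorted_wrt (<) (map \<iota> zs)" by simp
  then have 2: "sorted_wrt (\<lambda>a b. \<iota> a < \<iota> b) zs" by (simp add: sorted_wrt_map)
  have "sort_by \<iota> Z = zs" by (rule sort_by_eqI) (use 1 2 assms in auto)
  then show "set (sort_by \<iota> Z) = Z" "sorted_wrt (\<lambda>a b. \<iota> a < \<iota> b) (sort_by \<iota> Z)"
    using 1 2 by auto
qed

text \<open>On tuples of length \<open>m\<close>, the sorted list of the values of \<open>x\<close>
  is \<open>map x l\<close> for some list \<open>l\<close> of indices, and only finitely many
  \<open>l\<close> have length \<open>n\<close>. For a fixed \<open>l\<close>, being the sorting
  list is a finite system of comparisons between real keys. The preimage is thus a finite union of
  measurable sets.\<close>

lemma sort_by_preimage_measurable:
  assumes \<iota>: "\<iota> \<in> borel_measurable P" and inj: "inj_on \<iota> (space P)"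
    and B: "B \<in> sets (PiM {..<n} (\<lambda>_. P))"
  shows "{Z \<in> space (configM P). length (sort_by \<iota> Z) = n \<and> (\<lambda>i\<in>{..<n}. sort_by \<iota> Z ! i) \<in> B}
    \<in> sets (configM P)"
  (is "?A \<in> _")
proof (rule config_sets_in_sets)
  show "?A \<subseteq> {Z. finite Z \<and> Z \<subseteq> space P}" by (auto simp: space_configM)
next
  fix m :: nat
  let ?Q = "PiM {..<m} (\<lambda>_. P)"
  define L where "L = {l. set l \<subseteq> {..<m} \<and> length l = n}"
  \<comment> \<open>The three conditions say that \<open>l\<close> picks increasing keys, that it
    omits no value of \<open>x\<close>, and that the picked tuple lies in \<open>B\<close>. Equality
    of points is expressed through equality of keys, an equation between measurable real
    functions.\<close>
  define T where "T = (\<lambda>l. {x \<in> space ?Q. (\<forall>j<n. \<forall>i<j. \<iota> (x (l ! i)) < \<iota> (x (l ! j)))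
      \<and> (\<forall>k<m. \<exists>j<n. \<iota> (x k) = \<iota> (x (l ! j)))
      \<and> (\<lambda>i\<in>{..<n}. x (l ! i)) \<in> B})"
  have finL: "finite L" unfolding L_def by (rule finite_lists_length_eq) simp
  have comp: "(\<lambda>x. x k) \<in> measurable ?Q P" if "k < m" for k
    using that by (intro measurable_component_singleton) auto
  have pred_eq: "Measurable.pred ?Q (\<lambda>x. a x = b x)"
    if "a \<in> borel_measurable ?Q" "b \<in> borel_measurable ?Q" for a b :: "_ \<Rightarrow> real"
    unfolding Measurable.pred_def by (rule borel_measurable_eq[OF that])
  have T_sets: "T l \<in> sets ?Q" if l: "l \<in> L" for l
  proof -
    have lm: "l ! i < m" if "i < n" for i using l that by (auto simp: L_def dest: nth_mem)
    have \<iota>m: "(\<lambda>x. \<iota> (x k)) \<in> borel_measurable ?Q" if "k < m" for k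
      using measurable_compose[OF comp[OF that] \<iota>] .
    have 1: "Measurable.pred ?Q (\<lambda>x. \<forall>j<n. \<forall>i<j. \<iota> (x (l ! i)) < \<iota> (x (l ! j)))"
    proof -
      have "Measurable.pred ?Q (\<lambda>x. \<forall>j\<in>{..<n}. \<forall>i\<in>{..<j}. \<iota> (x (l ! i)) < \<iota> (x (l ! j)))"
        by (intro pred_intros_finite(3,4) borel_measurable_pred_less \<iota>m lm) auto
      then show ?thesis by (simp only: Ball_def Bex_def lessThan_iff)
    qed
    have 2: "Measurable.pred ?Q (\<lambda>x. \<forall>k<m. \<exists>j<n. \<iota> (x k) = \<iota> (x (l ! j)))"
    proof -
      have "Measurable.pred ?Q (\<lambda>x. \<forall>k\<in>{..<m}. \<exists>j\<in>{..<n}. \<iota> (x k) = \<iota> (x (l ! j)))"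
        by (intro pred_intros_finite(3,4) pred_eq \<iota>m lm) auto
      then show ?thesis by (simp only: Ball_def Bex_def lessThan_iff)
    qed
    have 3: "(\<lambda>x. \<lambda>i\<in>{..<n}. x (l ! i)) \<in> measurable ?Q (PiM {..<n} (\<lambda>_. P))"
      by (intro measurable_restrict comp lm) auto
    have 4: "Measurable.pred ?Q (\<lambda>x. (\<lambda>i\<in>{..<n}. x (l ! i)) \<in> B)"
      using measurable_sets[OF 3 B] by (simp add: pred_def vimage_def Int_def conj_commute)
    show ?thesis unfolding T_def
      by (intro sets.sets_Collect_conj 1[unfolded pred_def] 2[unfolded pred_def] 4[unfolded pred_def])
  qed
  have sound: "sort_by \<iota> (x ` {..<m}) = map x l" "length l = n" "(\<lambda>i\<in>{..<n}. map x l ! i) \<in> B"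
    if l: "l \<in> L" and x: "x \<in> T l" for x l
  proof -
    have xs: "x k \<in> space P" if "k < m" for k using x that by (auto simp: T_def space_PiM)
    have len: "length l = n" and lm: "\<And>i. i < n \<Longrightarrow> l ! i < m" using l by (auto simp: L_def dest: nth_mem)
    show "length l = n" by (rule len)
    have inj': "inj_on \<iota> (x ` {..<m})" by (rule inj_on_subset[OF inj]) (use xs in auto)
    show "sort_by \<iota> (x ` {..<m}) = map x l"
    proof (rule sort_by_eqI[OF inj'])
      show "sorted_wrt (\<lambda>a b. \<iota> a < \<iota> b) (map x l)"
        using x len by (auto simp: T_def sorted_wrt_iff_nth_less)
      have "x k \<in> set (map x l)" if "k < m" for k
      proof -
        obtain j where j: "j < n" "\<iota> (x k) = \<iota> (x (l ! j))" using x \<open>k < m\<close> by (auto simp: T_def)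
        then have "x k = x (l ! j)" using inj xs lm that by (meson inj_onD)
        then show ?thesis using j len by auto
      qed
      then show "set (map x l) = x ` {..<m}" using l by (auto simp: L_def)
    qed
    have "(\<lambda>i\<in>{..<n}. map x l ! i) = (\<lambda>i\<in>{..<n}. x (l ! i))"
      using len by (intro restrict_ext) auto
    then show "(\<lambda>i\<in>{..<n}. map x l ! i) \<in> B" using x by (auto simp: T_def)
  qed
  have complete: "\<exists>l\<in>L. x \<in> T l"
    if x: "x \<in> space ?Q" and len: "length (sort_by \<iota> (x ` {..<m})) = n"
      and inB: "(\<lambda>i\<in>{..<n}. sort_by \<iota> (x ` {..<m}) ! i) \<in> B" for x
  proof -
    have xs: "x k \<in> space P" if "k < m" for k using x that by (auto simp: space_PiM)
    have inj': "inj_on \<iota> (x ` {..<m})" by (rule inj_on_subset[OF inj]) (use xs in auto)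
    note s = sort_by[OF inj' finite_imageI[OF finite_lessThan]]
    \<comment> \<open>Choosing an index for every entry of the sorted list yields \<open>l\<close>.
      If \<open>x\<close> repeats values the choice is not unique, which is harmless for a
      union.\<close>
    have "sort_by \<iota> (x ` {..<m}) \<in> lists (x ` {..<m})" using s by auto
    then obtain l where l: "l \<in> lists {..<m}" "sort_by \<iota> (x ` {..<m}) = map x l"
      by (auto simp: lists_image)
    have len': "length l = n" using len l by simp
    have lL: "l \<in> L" using l len' by (auto simp: L_def)
    have eq: "(\<lambda>i\<in>{..<n}. map x l ! i) = (\<lambda>i\<in>{..<n}. x (l ! i))"
      using len' by (intro restrict_ext) auto
    have cover: "\<exists>j<n. \<iota> (x k) = \<iota> (x (l ! j))" if "k < m" for k
    proof -
      have "x k \<in> set (map x l)" using s(1) l that by auto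
      then show ?thesis using len' by (auto simp: in_set_conv_nth)
    qed
    have "x \<in> T l" unfolding T_def
      using x s(2) inB cover len' by (auto simp: l eq sorted_wrt_iff_nth_less)
    with lL show ?thesis by blast
  qed
  have "{x \<in> space ?Q. x ` {..<m} \<in> ?A} = (\<Union>l\<in>L. T l)" (is "?lhs = ?rhs")
  proof (intro equalityI subsetI)
    fix x assume "x \<in> ?lhs"
    then show "x \<in> ?rhs" using complete[of x] by auto
  next
    fix x assume "x \<in> ?rhs"
    then obtain l where l: "l \<in> L" "x \<in> T l" by blast
    have xQ: "x \<in> space ?Q" using l by (auto simp: T_def)
    then show "x \<in> ?lhs" using sound[OF l] by (auto simp: space_configM space_PiM)
  qed
  then show "{x \<in> space ?Q. x ` {..<m} \<in> ?A} \<in> sets ?Q" using finL T_sets by auto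
qed

text \<open>The \<sigma>-algebra on configurations is a quotient, and products do not commute with quotients in
  general. Sorting along an injective measurable function is a measurable section of the quotient map,
  which is what makes joint measurability testable on sequences.\<close>

lemma borel_measurable_pair_configM:
  fixes \<Phi> :: "'p \<Rightarrow> 'p set \<Rightarrow> real" and \<iota> :: "'p \<Rightarrow> real"
  assumes \<iota>: "\<iota> \<in> borel_measurable P" and inj: "inj_on \<iota> (space P)"
    and K: "\<And>n::nat. K n \<in> borel_measurable (P \<Otimes>\<^sub>M PiM {..<n} (\<lambda>_. P))"
    and eq: "\<And>n u x. inj_on x {..<n} \<Longrightarrow> K n (u, x) = \<Phi> u (x ` {..<n})"
  shows "(\<lambda>(u, Z). \<Phi> u Z) \<in> borel_measurable (P \<Otimes>\<^sub>M configM P)"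
proof (cases "space P = {}")
  case True
  then show ?thesis by (auto simp: measurable_def space_pair_measure)
next
  case False
  then obtain p where p: "p \<in> space P" by auto
  define len where "len = (\<lambda>Z. length (sort_by \<iota> Z))"
  \<comment> \<open>The constant tuple is a filler that makes \<open>tup n\<close> a total map into
    the \<open>n\<close>-th power; below, \<open>tup n\<close> is evaluated only with
    \<open>n = len Z\<close>.\<close>
  define tup where "tup = (\<lambda>n Z. if len Z = n then (\<lambda>i\<in>{..<n}. sort_by \<iota> Z ! i)
    else (\<lambda>i\<in>{..<n}. p))"
  have inj': "inj_on \<iota> Z" if "Z \<in> space (configM P)" for Z
    by (rule inj_on_subset[OF inj]) (use that in \<open>auto simp: space_configM\<close>)
  have set_s: "set (sort_by \<iota> Z) = Z" if "Z \<in> space (configM P)" for Z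
    using sort_by(1)[OF inj'[OF that]] that by (auto simp: space_configM)
  have tup_space: "(\<lambda>i\<in>{..<len Z}. sort_by \<iota> Z ! i) \<in> space (PiM {..<len Z} (\<lambda>_. P))"
    if "Z \<in> space (configM P)" for Z
    using set_s[OF that] that by (fastforce simp: space_PiM len_def space_configM dest: nth_mem)
  have pre: "{Z \<in> space (configM P). len Z = n \<and> (\<lambda>i\<in>{..<n}. sort_by \<iota> Z ! i) \<in> B} \<in> sets (configM P)"
    if "B \<in> sets (PiM {..<n} (\<lambda>_. P))" for n B
    unfolding len_def by (rule sort_by_preimage_measurable[OF \<iota> inj that])
  have len_sets: "{Z \<in> space (configM P). len Z = n} \<in> sets (configM P)" for n
  proof -
    have "{Z \<in> space (configM P). len Z = n} =
      {Z \<in> space (configM P). len Z = n \<and> (\<lambda>i\<in>{..<n}. sort_by \<iota> Z ! i) \<in> space (PiM {..<n} (\<lambda>_. P))}"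
      using tup_space by auto
    then show ?thesis using pre[OF sets.top, of n] by simp
  qed
  have len_m: "len \<in> measurable (configM P) (count_space UNIV)"
  proof (rule measurable_count_space_eq2_countable[THEN iffD2], safe)
    fix n
    have "len -` {n} \<inter> space (configM P) = {Z \<in> space (configM P). len Z = n}" by auto
    then show "len -` {n} \<inter> space (configM P) \<in> sets (configM P)" using len_sets by simp
  qed auto
  have tup_m: "tup n \<in> measurable (configM P) (PiM {..<n} (\<lambda>_. P))" for n
  proof (rule measurableI)
    fix Z assume Z: "Z \<in> space (configM P)"
    show "tup n Z \<in> space (PiM {..<n} (\<lambda>_. P))"
      using tup_space[OF Z] p by (auto simp: tup_def space_PiM)
  next
    fix B assume B: "B \<in> sets (PiM {..<n} (\<lambda>_. P))"
    have "tup n -` B \<inter> space (configM P) =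
      {Z \<in> space (configM P). len Z = n \<and> (\<lambda>i\<in>{..<n}. sort_by \<iota> Z ! i) \<in> B} \<union>
      (if (\<lambda>i\<in>{..<n}. p) \<in> B then space (configM P) - {Z \<in> space (configM P). len Z = n} else {})"
      by (auto simp: tup_def split: if_splits)
    also have "\<dots> \<in> sets (configM P)" using pre[OF B] len_sets by auto
    finally show "tup n -` B \<inter> space (configM P) \<in> sets (configM P)" .
  qed
  \<comment> \<open>The number of points takes countably many values, so measurability can be
    checked with this number held fixed.\<close>
  have "(\<lambda>w. K (len (snd w)) (fst w, tup (len (snd w)) (snd w))) \<in> borel_measurable (P \<Otimes>\<^sub>M configM P)"
  proof (rule measurable_compose_countable[of "\<lambda>n w. K n (fst w, tup n (snd w))"])
    fix n
    show "(\<lambda>w. K n (fst w, tup n (snd w))) \<in> borel_measurable (P \<Otimes>\<^sub>M configM P)"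
      by (rule measurable_compose[OF _ K])
        (intro measurable_Pair measurable_fst measurable_compose[OF measurable_snd tup_m])
  qed (rule measurable_compose[OF measurable_snd len_m])
  then show ?thesis
  proof (rule measurable_cong[THEN iffD1, rotated])
    fix w assume w: "w \<in> space (P \<Otimes>\<^sub>M configM P)"
    obtain u Z where uZ: "w = (u, Z)" by fastforce
    have Z: "Z \<in> space (configM P)" using w uZ by (auto simp: space_pair_measure)
    let ?s = "sort_by \<iota> Z"
    have "finite Z" using Z by (simp add: space_configM)
    then have "sorted_wrt (<) (map \<iota> ?s)"
      using sort_by(2)[OF inj'[OF Z]] by (simp add: sorted_wrt_map)
    \<comment> \<open>\<open>K\<close> is tied to \<Phi> only on injective tuples; a strictly sorted
      list supplies one.\<close>
    then have "distinct ?s" by (meson strict_sorted_iff distinct_map)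
    then have "inj_on (tup (len Z) Z) {..<len Z}"
      by (auto simp: tup_def len_def inj_on_def nth_eq_iff_index_eq)
    moreover have "tup (len Z) Z ` {..<len Z} = Z"
    proof -
      have "tup (len Z) Z ` {..<len Z} = set ?s"
        by (auto simp: tup_def len_def set_conv_nth)
      then show ?thesis using set_s[OF Z] by simp
    qed
    ultimately show "K (len (snd w)) (fst w, tup (len (snd w)) (snd w)) = (case w of (u, Z) \<Rightarrow> \<Phi> u Z)"
      by (simp add: uZ eq)
  qed
qed

text \<open>A list of measurable maps is a measurable map into a power of \<open>P\<close>, to which
  the slice of \<open>f\<close> applies. This covers permuted coordinates with a further point
  appended.\<close>

lemma borel_measurable_map_slices:
  fixes f :: "'p list \<Rightarrow> real"
  assumes f: "\<And>n. (\<lambda>x. f (map x [0..<n])) \<in> borel_measurable (PiM {..<n} (\<lambda>_. P))"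
    and cs: "\<And>c. c \<in> set cs \<Longrightarrow> c \<in> measurable M P"
  shows "(\<lambda>\<omega>. f (map (\<lambda>c. c \<omega>) cs)) \<in> borel_measurable M"
proof -
  have "(\<lambda>\<omega>. \<lambda>i\<in>{..<length cs}. (cs ! i) \<omega>) \<in> measurable M (PiM {..<length cs} (\<lambda>_. P))"
    by (intro measurable_restrict cs) auto
  from measurable_compose[OF this f]
  have "(\<lambda>\<omega>. f (map (\<lambda>i\<in>{..<length cs}. (cs ! i) \<omega>) [0..<length cs])) \<in> borel_measurable M" .
  moreover have "map (\<lambda>i\<in>{..<length cs}. (cs ! i) \<omega>) [0..<length cs] = map (\<lambda>c. c \<omega>) cs" for \<omega>
    by (rule nth_equalityI) auto
  ultimately show ?thesis by simp
qed

text \<open>The generating sets on sequences have measurable slices by definition, so turning a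
  tuple into a sequence is measurable.\<close>

lemma borel_measurable_ref_measure_slices:
  fixes f :: "((real^2) \<times> 'm) list \<Rightarrow> real"
  assumes "f \<in> borel_measurable (ref_measure mu muM D)"
  shows "(\<lambda>x. f (map x [0..<n])) \<in> borel_measurable (PiM {..<n} (\<lambda>_. markP mu muM D))"
proof (rule measurable_compose[OF _ assms])
  let ?P = "markP mu muM D"
  show "(\<lambda>x. map x [0..<n]) \<in> measurable (PiM {..<n} (\<lambda>_. ?P)) (ref_measure mu muM D)"
    unfolding ref_measure_def
  proof (rule measurable_measure_of)
    show "list_sets ?P \<subseteq> Pow {ys. set ys \<subseteq> space ?P}" by (auto simp: list_sets_def)
    show "(\<lambda>x. map x [0..<n]) \<in> space (PiM {..<n} (\<lambda>_. ?P)) \<rightarrow> {ys. set ys \<subseteq> space ?P}"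
      by (fastforce simp: space_PiM)
    fix F assume "F \<in> list_sets ?P"
    then have "{x \<in> space (PiM {..<n} (\<lambda>_. ?P)). map x [0..<n] \<in> F} \<in> sets (PiM {..<n} (\<lambda>_. ?P))"
      by (auto simp: list_sets_def powP_def)
    then show "(\<lambda>x. map x [0..<n]) -` F \<inter> space (PiM {..<n} (\<lambda>_. ?P)) \<in> sets (PiM {..<n} (\<lambda>_. ?P))"
      by (simp add: vimage_def Int_def conj_commute)
  qed
qed

section \<open>The interaction function\<close>

definition order_sum :: "('p list \<Rightarrow> real) \<Rightarrow> 'p set \<Rightarrow> real" where
  "order_sum f Z = (\<Sum>zs\<in>permutations_of_set Z. f zs)"

definition intensity :: "('p list \<Rightarrow> real) \<Rightarrow> 'p \<Rightarrow> 'p set \<Rightarrow> real" where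
  "intensity f u Z = order_sum (\<lambda>zs. f (zs @ [u])) Z / order_sum f Z"

text \<open>Moebius inversion as a recursion: the value at \<open>Z\<close> is the factor by which
  the product over proper subsets falls short of the intensity. Infinite sets are settled at once,
  so the cardinality drops in every recursive call. Where \<open>order_sum f Z\<close> is not
  positive, the value 1 is harmless for a Markov density, which vanishes on every listing of such a
  \<open>Z\<close>.\<close>

function interaction :: "('p list \<Rightarrow> real) \<Rightarrow> 'p \<Rightarrow> 'p set \<Rightarrow> real" where
  "interaction f u Z = (if infinite Z then 1 else
     if 0 < order_sum f Z \<and> (\<Prod>W\<in>Pow Z - {Z}. interaction f u W) \<noteq> 0
     then intensity f u Z / (\<Prod>W\<in>Pow Z - {Z}. interaction f u W) else 1)"
  by pat_completeness auto
termination
  by (relation "Wellfounded.measure (\<lambda>(f, u, Z). card Z)") (auto intro!: psubset_card_mono)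

declare interaction.simps [simp del]

text \<open>Replaces the orderings of a varying set by those of a fixed index set, so that the sum
  becomes a finite sum of measurable functions of \<open>x\<close>.\<close>

lemma order_sum_image:
  assumes "inj_on x I"
  shows "order_sum f (x ` I) = (\<Sum>l\<in>permutations_of_set I. f (map x l))"
proof -
  have "inj_on (map x) (permutations_of_set I)"
    by (rule inj_onI) (use assms in \<open>auto simp: permutations_of_set_def inj_on_map_eq_map\<close>)
  then show ?thesis
    unfolding order_sum_def permutations_of_set_image_inj[OF assms] by (simp add: sum.reindex)
qed

text \<open>The induction runs over index sets instead of configurations, which turns the recursion
  for \<open>interaction\<close> into a finite expression in measurable functions. The values agree
  on injective tuples, where subsets of \<open>I\<close> match subsets of the image; elsewhere
  \<open>K\<close> is whatever the same formula gives.\<close>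

lemma ex_measurable_interaction_image:
  fixes f :: "'p list \<Rightarrow> real" and I :: "'i set"
  assumes f: "\<And>n. (\<lambda>x. f (map x [0..<n])) \<in> borel_measurable (PiM {..<n} (\<lambda>_. P))"
    and "finite I"
  shows "\<exists>K \<in> borel_measurable (P \<Otimes>\<^sub>M PiM I (\<lambda>_. P)).
           \<forall>u x. inj_on x I \<longrightarrow> K (u, x) = interaction f u (x ` I)"
  using \<open>finite I\<close>
proof (induction I rule: finite_psubset_induct)
  case (psubset I)
  let ?Q = "P \<Otimes>\<^sub>M PiM I (\<lambda>_. P)"
  have "\<forall>W\<in>Pow I - {I}. \<exists>K. K \<in> borel_measurable (P \<Otimes>\<^sub>M PiM W (\<lambda>_. P)) \<and>
           (\<forall>u x. inj_on x W \<longrightarrow> K (u, x) = interaction f u (x ` W))"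
    using psubset.IH by (metis Diff_iff Pow_iff insertCI psubsetI)
  then obtain K where K: "\<And>W. W \<in> Pow I - {I} \<Longrightarrow> K W \<in> borel_measurable (P \<Otimes>\<^sub>M PiM W (\<lambda>_. P))"
    and K_eq: "\<And>W u x. W \<in> Pow I - {I} \<Longrightarrow> inj_on x W \<Longrightarrow> K W (u, x) = interaction f u (x ` W)"
    by (metis (no_types, lifting) bchoice)
  define p where "p = (\<lambda>\<omega>. \<Prod>W\<in>Pow I - {I}. K W (fst \<omega>, restrict (snd \<omega>) W))"
  define s where "s = (\<lambda>\<omega> :: 'p \<times> ('i \<Rightarrow> 'p). \<Sum>l\<in>permutations_of_set I. f (map (snd \<omega>) l))"
  define s' where "s' = (\<lambda>\<omega>. \<Sum>l\<in>permutations_of_set I. f (map (snd \<omega>) l @ [fst \<omega>]))"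
  have comp: "(\<lambda>\<omega>. snd \<omega> i) \<in> measurable ?Q P" if "i \<in> I" for i
    by (rule measurable_compose[OF measurable_snd measurable_component_singleton[OF that]])
  have p_m [measurable]: "p \<in> borel_measurable ?Q"
    unfolding p_def
  proof (rule borel_measurable_prod)
    fix W assume W: "W \<in> Pow I - {I}"
    show "(\<lambda>\<omega>. K W (fst \<omega>, restrict (snd \<omega>) W)) \<in> borel_measurable ?Q"
      by (rule measurable_compose[OF _ K[OF W]])
        (use W in \<open>intro measurable_Pair measurable_fst measurable_compose[OF measurable_snd]
          measurable_restrict_subset; auto\<close>)
  qed
  have s_m [measurable]: "s \<in> borel_measurable ?Q"
    unfolding s_def
  proof (rule borel_measurable_sum)
    fix l assume l: "l \<in> permutations_of_set I"
    have "(\<lambda>\<omega>. f (map (\<lambda>c. c \<omega>) (map (\<lambda>i \<omega>. snd \<omega> i) l))) \<in> borel_measurable ?Q"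
      by (rule borel_measurable_map_slices[OF f])
        (use l comp in \<open>auto simp: permutations_of_set_def\<close>)
    then show "(\<lambda>\<omega>. f (map (snd \<omega>) l)) \<in> borel_measurable ?Q" by (simp add: comp_def)
  qed
  have s'_m [measurable]: "s' \<in> borel_measurable ?Q"
    unfolding s'_def
  proof (rule borel_measurable_sum)
    fix l assume l: "l \<in> permutations_of_set I"
    have "(\<lambda>\<omega>. f (map (\<lambda>c. c \<omega>) (map (\<lambda>i \<omega>. snd \<omega> i) l @ [fst]))) \<in> borel_measurable ?Q"
      by (rule borel_measurable_map_slices[OF f])
        (use l comp in \<open>auto simp: permutations_of_set_def\<close>)
    then show "(\<lambda>\<omega>. f (map (snd \<omega>) l @ [fst \<omega>])) \<in> borel_measurable ?Q" by (simp add: comp_def)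
  qed
  have "(\<lambda>\<omega>. if 0 < s \<omega> \<and> p \<omega> \<noteq> 0 then s' \<omega> / s \<omega> / p \<omega> else 1) \<in> borel_measurable ?Q"
    by measurable
  moreover have "(if 0 < s (u, x) \<and> p (u, x) \<noteq> 0 then s' (u, x) / s (u, x) / p (u, x) else 1)
      = interaction f u (x ` I)" if inj: "inj_on x I" for u x
  proof -
    have s: "s (u, x) = order_sum f (x ` I)" unfolding s_def using order_sum_image[OF inj] by simp
    have s': "s' (u, x) / s (u, x) = intensity f u (x ` I)"
      unfolding s s'_def intensity_def by (simp add: order_sum_image[OF inj])
    \<comment> \<open>By injectivity, proper subsets of \<open>I\<close> correspond to proper
      subsets of the image, so the two recursive products have the same factors.\<close>
    have bij: "bij_betw (image x) (Pow I - {I}) (Pow (x ` I) - {x ` I})"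
    proof (rule bij_betw_imageI)
      show "inj_on (image x) (Pow I - {I})"
        by (rule inj_on_subset[OF inj_on_image_Pow[OF inj]]) auto
      have "image x ` (Pow I - {I}) = image x ` Pow I - image x ` {I}"
        by (rule inj_on_image_set_diff[OF inj_on_image_Pow[OF inj]]) auto
      then show "image x ` (Pow I - {I}) = Pow (x ` I) - {x ` I}" by (simp add: image_Pow_surj)
    qed
    have "p (u, x) = (\<Prod>W\<in>Pow I - {I}. interaction f u (x ` W))"
      unfolding p_def
    proof (rule prod.cong[OF refl])
      fix W assume W: "W \<in> Pow I - {I}"
      have "inj_on (restrict x W) W" using inj W by (auto intro: inj_on_subset)
      from K_eq[OF W this] show "K W (fst (u, x), restrict (snd (u, x)) W) = interaction f u (x ` W)"
        by simp
    qed
    also have "\<dots> = (\<Prod>W\<in>Pow (x ` I) - {x ` I}. interaction f u W)"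
      by (rule prod.reindex_bij_betw[OF bij])
    finally have p: "p (u, x) = (\<Prod>W\<in>Pow (x ` I) - {x ` I}. interaction f u W)" .
    show ?thesis
      unfolding s' p unfolding s using psubset.hyps by (simp add: interaction.simps[of f u "x ` I"])
  qed
  ultimately show ?case
    by (intro bexI[of _ "\<lambda>\<omega>. if 0 < s \<omega> \<and> p \<omega> \<noteq> 0 then s' \<omega> / s \<omega> / p \<omega> else 1"]) auto
qed

lemma borel_measurable_interaction:
  fixes \<iota> :: "'p \<Rightarrow> real"
  assumes "\<iota> \<in> borel_measurable P" "inj_on \<iota> (space P)"
    and f: "\<And>n. (\<lambda>x. f (map x [0..<n])) \<in> borel_measurable (PiM {..<n} (\<lambda>_. P))"
  shows "(\<lambda>(u, Z). interaction f u Z) \<in> borel_measurable (P \<Otimes>\<^sub>M configM P)"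
proof -
  have "\<forall>n::nat. \<exists>K. K \<in> borel_measurable (P \<Otimes>\<^sub>M PiM {..<n} (\<lambda>_. P)) \<and>
           (\<forall>u x. inj_on x {..<n} \<longrightarrow> K (u, x) = interaction f u (x ` {..<n}))"
    using ex_measurable_interaction_image[of f P "{..<_::nat}", OF f finite_lessThan] by blast
  then obtain K where "\<And>n::nat. K n \<in> borel_measurable (P \<Otimes>\<^sub>M PiM {..<n} (\<lambda>_. P))"
    "\<And>n u x. inj_on x {..<n} \<Longrightarrow> K n (u, x) = interaction f u (x ` {..<n})" by metis
  then show ?thesis by (rule borel_measurable_pair_configM[OF assms(1,2)])
qed

section \<open>Markov densities\<close>

locale markov_density =
  fixes S :: "'p set" and R :: "'p \<Rightarrow> 'p \<Rightarrow> bool" and f :: "'p list \<Rightarrow> real"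
  assumes markov: "markov S R f"
    and nonneg: "set ys \<subseteq> S \<Longrightarrow> 0 \<le> f ys"
begin

lemma pos_subseq: "set ys \<subseteq> S \<Longrightarrow> 0 < f ys \<Longrightarrow> subseq zs ys \<Longrightarrow> 0 < f zs"
  using markov[unfolded markov_def, THEN conjunct1] by blast

lemma append_eq_0:
  assumes "set ys \<subseteq> S" "u \<in> S" "f ys = 0"
  shows "f (ys @ [u]) = 0"
proof (rule ccontr)
  assume "f (ys @ [u]) \<noteq> 0"
  then have "0 < f (ys @ [u])" using nonneg[of "ys @ [u]"] assms by auto
  from pos_subseq[OF _ this, of ys] assms show False by auto
qed

text \<open>The listing \<open>ys\<close> may repeat points, while \<open>order_sum\<close> sees
  only repetition-free ones. As \<open>remdups ys\<close> is a subsequence of \<open>ys\<close>, it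
  inherits positivity and is a positive summand.\<close>

lemma order_sum_pos_iff:
  assumes "finite Z" "Z \<subseteq> S"
  shows "0 < order_sum f Z \<longleftrightarrow> (\<exists>ys. set ys = Z \<and> 0 < f ys)"
proof
  assume "0 < order_sum f Z"
  then obtain zs where "zs \<in> permutations_of_set Z" "0 < f zs"
    unfolding order_sum_def by (meson linorder_not_le sum_nonpos)
  then show "\<exists>ys. set ys = Z \<and> 0 < f ys" by (auto simp: permutations_of_set_def)
next
  assume "\<exists>ys. set ys = Z \<and> 0 < f ys"
  then obtain ys where ys: "set ys = Z" "0 < f ys" by blast
  have "subseq (remdups ys) ys" by (induction ys) auto
  then have "0 < f (remdups ys)" using pos_subseq ys assms by blast
  then show "0 < order_sum f Z" unfolding order_sum_def
    by (intro sum_pos2[of _ "remdups ys"])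
      (use ys assms in \<open>auto intro!: nonneg permutations_of_setI dest: permutations_of_setD\<close>)
qed

text \<open>All orderings of \<open>Z\<close> give \<open>u\<close> the same neighbours, so the
  factor \<open>g\<close> comes out of the sum over orderings. Orderings of density zero fit in,
  since appending a point keeps the density zero. Both facts share one \<open>g\<close>, which lets
  later proofs compare them.\<close>

lemma intensity_depends_on_neighbours:
  obtains g where "\<And>u Z. finite Z \<Longrightarrow> Z \<subseteq> S \<Longrightarrow> u \<in> S \<Longrightarrow> 0 < order_sum f Z \<Longrightarrow>
      intensity f u Z = g u {y \<in> Z. R u y}"
    and "\<And>u ys. set ys \<subseteq> S \<Longrightarrow> u \<in> S \<Longrightarrow> f (ys @ [u]) = g u {y \<in> set ys. R u y} * f ys"
proof -
  obtain g where g: "\<And>ys u. set ys \<subseteq> S \<Longrightarrow> f ys > 0 \<Longrightarrow> u \<in> S \<Longrightarrow>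
          f (ys @ [u]) / f ys = g u {y \<in> set ys. R u y}"
    using markov by (auto simp: markov_def)
  have app: "f (ys @ [u]) = g u {y \<in> set ys. R u y} * f ys" if "set ys \<subseteq> S" "u \<in> S" for u ys
  proof (cases "f ys = 0")
    case True
    then show ?thesis using append_eq_0 that by simp
  next
    case False
    then have "0 < f ys" using nonneg[OF that(1)] by simp
    then show ?thesis using g[OF that(1) _ that(2)] by (simp add: field_simps)
  qed
  moreover have "intensity f u Z = g u {y \<in> Z. R u y}"
    if "finite Z" "Z \<subseteq> S" "u \<in> S" "0 < order_sum f Z" for u Z
  proof -
    have "order_sum (\<lambda>zs. f (zs @ [u])) Z = g u {y \<in> Z. R u y} * order_sum f Z"
      unfolding order_sum_def sum_distrib_left
      by (rule sum.cong[OF refl]) (use app that in \<open>auto simp: permutations_of_set_def\<close>)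
    then show ?thesis using that by (simp add: intensity_def)
  qed
  ultimately show ?thesis by (intro that)
qed

text \<open>Even if \<open>ys\<close> has repetitions, it and the orderings of \<open>set ys\<close>
  have the same neighbour set, hence the same value of \<open>g\<close>.\<close>

lemma append_eq_intensity:
  assumes "set ys \<subseteq> S" "u \<in> S" "0 < f ys"
  shows "f (ys @ [u]) = intensity f u (set ys) * f ys"
proof -
  have "0 < order_sum f (set ys)" using order_sum_pos_iff[of "set ys"] assms by auto
  moreover obtain g where
    "\<And>u Z. finite Z \<Longrightarrow> Z \<subseteq> S \<Longrightarrow> u \<in> S \<Longrightarrow> 0 < order_sum f Z \<Longrightarrow>
      intensity f u Z = g u {y \<in> Z. R u y}"
    "\<And>u ys. set ys \<subseteq> S \<Longrightarrow> u \<in> S \<Longrightarrow> f (ys @ [u]) = g u {y \<in> set ys. R u y} * f ys"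
    using intensity_depends_on_neighbours by blast
  ultimately show ?thesis using assms by simp
qed

text \<open>Taking the neighbours of \<open>u\<close> is idempotent, so both intensities are the
  same value of \<open>g\<close>.\<close>

lemma intensity_neighbours:
  assumes "finite Z" "Z \<subseteq> S" "u \<in> S" "0 < order_sum f Z" "0 < order_sum f {y \<in> Z. R u y}"
  shows "intensity f u {y \<in> Z. R u y} = intensity f u Z"
proof -
  obtain g where g: "\<And>u Z. finite Z \<Longrightarrow> Z \<subseteq> S \<Longrightarrow> u \<in> S \<Longrightarrow> 0 < order_sum f Z \<Longrightarrow>
      intensity f u Z = g u {y \<in> Z. R u y}"
      "\<And>u ys. set ys \<subseteq> S \<Longrightarrow> u \<in> S \<Longrightarrow> f (ys @ [u]) = g u {y \<in> set ys. R u y} * f ys"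
    using intensity_depends_on_neighbours by blast
  have "{y \<in> {y \<in> Z. R u y}. R u y} = {y \<in> Z. R u y}" by auto
  then show ?thesis using g(1)[of Z u] g(1)[of "{y \<in> Z. R u y}" u] assms by auto
qed

lemma intensity_nonneg:
  assumes "Z \<subseteq> S" "u \<in> S"
  shows "0 \<le> intensity f u Z"
  unfolding intensity_def order_sum_def
proof (intro divide_nonneg_nonneg sum_nonneg)
  fix zs assume "zs \<in> permutations_of_set Z"
  then have "set zs = Z" by (rule permutations_of_setD)
  then show "0 \<le> f (zs @ [u])" "0 \<le> f zs" using assms by (auto intro!: nonneg)
qed

lemma order_sum_pos_subset:
  assumes "finite Z" "Z \<subseteq> S" "W \<subseteq> Z" "0 < order_sum f Z"
  shows "0 < order_sum f W"
proof -
  obtain ys where ys: "set ys = Z" "0 < f ys" using assms order_sum_pos_iff by blast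
  have "0 < f (filter (\<lambda>y. y \<in> W) ys)" using pos_subseq[of ys] ys assms by auto
  moreover have "set (filter (\<lambda>y. y \<in> W) ys) = W" using ys assms by auto
  ultimately show ?thesis
    using order_sum_pos_iff[of W] finite_subset[OF assms(3,1)] assms(2,3) by blast
qed

text \<open>If the intensity at \<open>Z\<close> were nonzero, a positive listing of
  \<open>Z\<close> would stay positive after appending \<open>u\<close>. Filtering it to
  \<open>W\<close> and keeping \<open>u\<close> gives a subsequence, so the intensity at
  \<open>W\<close> would be nonzero too.\<close>

lemma intensity_subset_eq_0:
  assumes "finite Z" "Z \<subseteq> S" "u \<in> S" "W \<subseteq> Z" "0 < order_sum f Z" "intensity f u W = 0"
  shows "intensity f u Z = 0"
proof (rule ccontr)
  assume nz: "intensity f u Z \<noteq> 0"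
  obtain ys where ys: "set ys = Z" "0 < f ys" using assms order_sum_pos_iff by blast
  let ?ws = "filter (\<lambda>y. y \<in> W) ys"
  have ws: "set ?ws = W" using ys assms by auto
  have "f (ys @ [u]) = intensity f u Z * f ys" using append_eq_intensity[of ys u] ys assms by auto
  then have "0 < f (ys @ [u])"
    using nz intensity_nonneg[of Z u] assms ys by (simp add: less_le)
  then have "0 < f (?ws @ [u])"
    by (rule pos_subseq[rotated]) (use ys assms in \<open>auto intro: list_emb_append_mono\<close>)
  moreover have "0 < f ?ws" using pos_subseq[of ys] ys assms by auto
  ultimately show False using append_eq_intensity[of ?ws u] ws assms by auto
qed

lemma interaction_nonneg:
  assumes "finite Z" "Z \<subseteq> S" "u \<in> S"
  shows "0 \<le> interaction f u Z"
  using assms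
proof (induction Z rule: finite_psubset_induct)
  case (psubset Z)
  have "0 \<le> (\<Prod>W\<in>Pow Z - {Z}. interaction f u W)"
    by (rule prod_nonneg) (use psubset in blast)
  then show ?case using intensity_nonneg[of Z u] psubset.prems
    by (subst interaction.simps) auto
qed

text \<open>With a nonzero product over proper subsets the recursion gives the identity at once; the
  content lies in the case of a zero product.\<close>

lemma prod_interaction:
  assumes "finite Z" "Z \<subseteq> S" "u \<in> S" "0 < order_sum f Z"
  shows "(\<Prod>W\<in>Pow Z. interaction f u W) = intensity f u Z"
  using assms
proof (induction Z rule: finite_psubset_induct)
  case (psubset Z)
  let ?p = "\<Prod>W\<in>Pow Z - {Z}. interaction f u W"
  have split: "(\<Prod>W\<in>Pow Z. interaction f u W) = interaction f u Z * ?p"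
    by (rule prod.remove) (use psubset.hyps in auto)
  show ?case
  proof (cases "?p = 0")
    case False
    then have "interaction f u Z = intensity f u Z / ?p"
      using psubset by (subst interaction.simps) simp
    then show ?thesis using False split by simp
  next
    \<comment> \<open>A vanishing factor at a proper subset \<open>W\<close> also occurs in the
      product over \<open>Pow W\<close>. By induction the intensity at \<open>W\<close> is zero, and
      this zero persists at \<open>Z\<close>.\<close>
    case True
    then obtain W where W: "W \<subset> Z" "interaction f u W = 0" using psubset.hyps by auto
    then have finW: "finite W" using psubset.hyps finite_subset by blast
    have "intensity f u W = (\<Prod>V\<in>Pow W. interaction f u V)"
      using psubset.IH[OF W(1)] order_sum_pos_subset[of Z W] psubset.prems psubset.hyps W by auto
    also have "\<dots> = 0" using W finW by (intro prod_zero) auto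
    finally have "intensity f u Z = 0"
      using intensity_subset_eq_0[of Z u W] psubset.prems psubset.hyps W by auto
    then show ?thesis using split True by simp
  qed
qed

text \<open>The neighbours \<open>?N\<close> of \<open>u\<close> form a proper subset of
  \<open>Z\<close>. Proper subsets of \<open>Z\<close> not inside \<open>?N\<close> are non-cliques
  and contribute 1 by induction. What remains is the product over \<open>Pow ?N\<close>, which is
  the intensity at \<open>?N\<close> and hence at \<open>Z\<close>; so the quotient in the recursion
  is 1.\<close>

lemma interaction_eq_1:
  assumes "finite Z" "Z \<subseteq> S" "u \<in> S" "\<not> u_clique R u Z"
  shows "interaction f u Z = 1"
  using assms
proof (induction Z rule: finite_psubset_induct)
  case (psubset Z)
  let ?p = "\<Prod>W\<in>Pow Z - {Z}. interaction f u W"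
  let ?N = "{y \<in> Z. R u y}"
  show ?case
  proof (cases "0 < order_sum f Z \<and> ?p \<noteq> 0")
    case False
    then show ?thesis by (subst interaction.simps) auto
  next
    case True
    have N: "?N \<subset> Z" using psubset.prems by (auto simp: u_clique_def)
    have posN: "0 < order_sum f ?N"
      using order_sum_pos_subset[of Z ?N] True psubset.prems psubset.hyps by auto
    have "?p = (\<Prod>W\<in>Pow ?N. interaction f u W)"
    proof (rule prod.mono_neutral_right)
      show "\<forall>W\<in>Pow Z - {Z} - Pow ?N. interaction f u W = 1"
      proof
        fix W assume W: "W \<in> Pow Z - {Z} - Pow ?N"
        then have "W \<subset> Z" "\<not> u_clique R u W" by (auto simp: u_clique_def)
        then show "interaction f u W = 1" using psubset by auto
      qed
    qed (use psubset.hyps N in auto)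
    also have "\<dots> = intensity f u ?N"
      using prod_interaction[of ?N u] posN psubset by auto
    also have "\<dots> = intensity f u Z"
      using intensity_neighbours[of Z u] posN True psubset by auto
    finally show ?thesis using True psubset.hyps by (subst interaction.simps) simp
  qed
qed

end

section \<open>The product formula and its converse\<close>

lemma prod_sequential_snoc:
  "(\<Prod>i<length (ys @ [u]). \<Prod>Z\<in>Pow (set (take i (ys @ [u]))). \<phi> ((ys @ [u]) ! i) Z) =
   (\<Prod>i<length ys. \<Prod>Z\<in>Pow (set (take i ys)). \<phi> (ys ! i) Z) * (\<Prod>Z\<in>Pow (set ys). \<phi> u Z)"
  for \<phi> :: "'p \<Rightarrow> 'p set \<Rightarrow> 'a::comm_monoid_mult"
proof -
  have "(\<Prod>i<length ys. \<Prod>Z\<in>Pow (set (take i (ys @ [u]))). \<phi> ((ys @ [u]) ! i) Z) =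
      (\<Prod>i<length ys. \<Prod>Z\<in>Pow (set (take i ys)). \<phi> (ys ! i) Z)"
    by (intro prod.cong refl) (simp_all add: nth_append)
  then show ?thesis by (simp del: Pow_insert)
qed

text \<open>Induction from the end of the sequence. The factor for the last point is its intensity
  if the earlier points have positive density; otherwise both sides are zero.\<close>

lemma (in markov_density) factorization:
  assumes "set ys \<subseteq> S"
  shows "f ys = f [] * (\<Prod>i<length ys. \<Prod>Z\<in>Pow (set (take i ys)). interaction f (ys ! i) Z)"
  using assms
proof (induction ys rule: rev_induct)
  case Nil
  then show ?case by simp
next
  case (snoc u ys)
  then have S: "set ys \<subseteq> S" "u \<in> S" by auto
  note IH = snoc.IH[OF S(1)]
  have "f (ys @ [u]) = f ys * (\<Prod>Z\<in>Pow (set ys). interaction f u Z)"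
  proof (cases "f ys = 0")
    case True
    then show ?thesis using append_eq_0 S by simp
  next
    case False
    then have pos: "0 < f ys" using nonneg[OF S(1)] by simp
    then have "0 < order_sum f (set ys)" using order_sum_pos_iff[of "set ys"] S by auto
    then show ?thesis using append_eq_intensity[OF S pos] prod_interaction[of "set ys" u] S by simp
  qed
  then show ?case unfolding prod_sequential_snoc using IH by (simp add: mult.assoc)
qed

text \<open>Appending \<open>u\<close> multiplies the density by the product over
  \<open>Pow (set ys)\<close>. Non-cliques contribute 1 to it, so only subsets of the neighbour set
  matter.\<close>

lemma markov_if_factorization:
  fixes f :: "'p list \<Rightarrow> real"
  assumes nonneg: "\<And>ys. set ys \<subseteq> S \<Longrightarrow> 0 \<le> f ys"
    and \<phi>_nonneg: "\<And>u Z. u \<in> S \<Longrightarrow> finite Z \<Longrightarrow> Z \<subseteq> S \<Longrightarrow> 0 \<le> \<phi> u Z"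
    and \<phi>_1: "\<And>u Z. u \<in> S \<Longrightarrow> finite Z \<Longrightarrow> Z \<subseteq> S \<Longrightarrow> \<not> u_clique R u Z \<Longrightarrow> \<phi> u Z = 1"
    and fact: "\<And>ys. set ys \<subseteq> S \<Longrightarrow>
      f ys = f [] * (\<Prod>i<length ys. \<Prod>Z\<in>Pow (set (take i ys)). \<phi> (ys ! i) Z)"
  shows "markov S R f"
proof -
  have app: "f (ys @ [u]) = f ys * (\<Prod>Z\<in>Pow (set ys). \<phi> u Z)" if "set ys \<subseteq> S" "u \<in> S" for ys u
  proof -
    have "set (ys @ [u]) \<subseteq> S" using that by auto
    from fact[OF this] show ?thesis unfolding prod_sequential_snoc using fact[OF that(1)] by simp
  qed
  \<comment> \<open>Both conditions on the right are inherited by subsequences of \<open>ys\<close>,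
    which drives the induction for heredity.\<close>
  have pos_iff: "0 < f (ys @ [u]) \<longleftrightarrow> 0 < f ys \<and> (\<forall>Z\<subseteq>set ys. \<phi> u Z \<noteq> 0)"
    if "set ys \<subseteq> S" "u \<in> S" for ys u
  proof -
    have "0 < f (ys @ [u]) \<longleftrightarrow> f (ys @ [u]) \<noteq> 0" "0 < f ys \<longleftrightarrow> f ys \<noteq> 0"
      using nonneg[of "ys @ [u]"] nonneg[of ys] that by auto
    then show ?thesis using app[OF that] by auto
  qed
  have sub: "0 < f zs" if "subseq zs ys" "set ys \<subseteq> S" "0 < f ys" for zs ys
    using that
  proof (induction ys arbitrary: zs rule: rev_induct)
    case Nil
    then show ?case using list_emb_Nil2 by blast
  next
    case (snoc u ys)
    have S: "set ys \<subseteq> S" "u \<in> S" using snoc.prems by auto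
    have pos: "0 < f ys" "\<forall>Z\<subseteq>set ys. \<phi> u Z \<noteq> 0" using pos_iff[OF S] snoc.prems by auto
    \<comment> \<open>A subsequence of \<open>ys @ [u]\<close> is a subsequence of
      \<open>ys\<close>, followed by \<open>u\<close> or by nothing.\<close>
    obtain as bs where zs: "zs = as @ bs" "subseq as ys" "subseq bs [u]"
      using snoc.prems(1) by (meson subseq_appendE)
    have as: "0 < f as" "set as \<subseteq> set ys"
      using snoc.IH[OF zs(2) S(1) pos(1)] list_emb_set[OF zs(2)] by auto
    have "bs = [] \<or> bs = [u]" using zs(3) by (cases bs) (auto split: if_splits)
    then show ?case
    proof
      assume "bs = []"
      then show ?thesis using as zs by simp
    next
      assume "bs = [u]"
      then show ?thesis using pos_iff[of as u] as S pos zs by auto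
    qed
  qed
  have "f (ys @ [u]) / f ys = (\<Prod>Z\<in>Pow {y \<in> set ys. R u y}. \<phi> u Z)"
    if "set ys \<subseteq> S" "0 < f ys" "u \<in> S" for ys u
  proof -
    have "(\<Prod>Z\<in>Pow (set ys). \<phi> u Z) = (\<Prod>Z\<in>Pow {y \<in> set ys. R u y}. \<phi> u Z)"
    proof (rule prod.mono_neutral_right)
      show "\<forall>Z\<in>Pow (set ys) - Pow {y \<in> set ys. R u y}. \<phi> u Z = 1"
      proof
        fix Z assume Z: "Z \<in> Pow (set ys) - Pow {y \<in> set ys. R u y}"
        then have "finite Z" "Z \<subseteq> S" "\<not> u_clique R u Z"
          using that finite_subset[of Z "set ys"] by (auto simp: u_clique_def)
        then show "\<phi> u Z = 1" using \<phi>_1 that by blast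
      qed
    qed auto
    then show ?thesis using app[OF that(1,3)] that(2) by simp
  qed
  then show ?thesis unfolding markov_def using sub
    by (intro conjI exI[of _ "\<lambda>u N. \<Prod>Z\<in>Pow N. \<phi> u Z"]) blast+
qed

section \<open>The equivalence for sequential marked point processes\<close>

theorem theorem1:
  fixes D :: "(real^2) set" and mu :: "(real^2) measure"
    and muM :: "'m::polish_space measure"
    and f :: "((real^2) \<times> 'm) list \<Rightarrow> real"
    and R :: "(real^2) \<times> 'm \<Rightarrow> (real^2) \<times> 'm \<Rightarrow> bool"
  assumes D_borel: "D \<in> sets borel" and D_bounded: "bounded D"
    and mu_borel: "sets mu = sets borel"
    and mu_finite: "emeasure mu D < \<infinity>"
    and mu_diffuse: "\<forall>x\<in>D. emeasure mu {x} = 0"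
    and mu_pos: "emeasure mu D > 0"
    and muM_prob: "prob_space muM" and muM_borel: "sets muM = sets borel"
    and f_meas: "f \<in> borel_measurable (ref_measure mu muM D)"
    and f_nonneg: "\<forall>ys. set ys \<subseteq> D \<times> UNIV \<longrightarrow> f ys \<ge> 0"
    and f_density: "(\<integral>\<^sup>+ ys. ennreal (f ys) \<partial>ref_measure mu muM D) = 1"
    and R_refl: "\<forall>u \<in> D \<times> UNIV. R u u"
  shows "markov (D \<times> UNIV) R f \<longleftrightarrow>
    (\<exists>\<phi> :: (real^2) \<times> 'm \<Rightarrow> ((real^2) \<times> 'm) set \<Rightarrow> real.
        (\<lambda>(u, Z). \<phi> u Z) \<in> borel_measurable (markP mu muM D \<Otimes>\<^sub>M configM (markP mu muM D)) \<and>
        (\<forall>u \<in> D \<times> UNIV. \<forall>Z. finite Z \<and> Z \<subseteq> D \<times> UNIV \<longrightarrow> \<phi> u Z \<ge> 0) \<and>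
        (\<forall>u \<in> D \<times> UNIV. \<forall>Z. finite Z \<and> Z \<subseteq> D \<times> UNIV \<and> \<not> u_clique R u Z \<longrightarrow> \<phi> u Z = 1) \<and>
        (\<forall>ys. set ys \<subseteq> D \<times> UNIV \<longrightarrow>
           f ys = f [] * (\<Prod>i<length ys. \<Prod>Z\<in>Pow (set (take i ys)). \<phi> (ys ! i) Z)))"
  (is "?markov \<longleftrightarrow> (\<exists>\<phi>. ?factorizes \<phi>)")
proof
  assume ?markov
  then interpret markov_density "D \<times> UNIV" R f
    by unfold_locales (use f_nonneg in auto)
  \<comment> \<open>The plane and the mark space are Polish, so their product is second countable
    and Hausdorff and admits the sorting key.\<close>
  obtain \<iota> :: "(real^2) \<times> 'm \<Rightarrow> real" where \<iota>: "\<iota> \<in> borel_measurable borel" "inj \<iota>"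
    using ex_inj_borel_measurable_real by blast
  \<comment> \<open>The key is Borel for the product topology; for second countable factors this
    \<sigma>-algebra is the product of the Borel ones.\<close>
  have "sets (mu \<Otimes>\<^sub>M muM) = sets (borel :: ((real^2) \<times> 'm) measure)"
    unfolding borel_prod[symmetric] by (rule sets_pair_measure_cong[OF mu_borel muM_borel])
  then have "\<iota> \<in> borel_measurable (mu \<Otimes>\<^sub>M muM)"
    using \<iota>(1) by (simp cong: measurable_cong_sets)
  then have "\<iota> \<in> borel_measurable (markP mu muM D)"
    unfolding markP_def by (rule measurable_restrict_space1)
  then have "(\<lambda>(u, Z). interaction f u Z) \<in>
      borel_measurable (markP mu muM D \<Otimes>\<^sub>M configM (markP mu muM D))"
    by (rule borel_measurable_interaction)
      (use \<iota>(2) borel_measurable_ref_measure_slices[OF f_meas] in \<open>auto intro: inj_on_subset\<close>)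
  then have "?factorizes (interaction f)"
    using interaction_nonneg interaction_eq_1 factorization
    by (intro conjI ballI allI impI) (assumption | blast)+
  then show "\<exists>\<phi>. ?factorizes \<phi>" by (rule exI[of _ "interaction f"])
next
  assume "\<exists>\<phi>. ?factorizes \<phi>"
  then obtain \<phi> where \<phi>: "?factorizes \<phi>" ..
  show ?markov
  proof (rule markov_if_factorization)
    show "0 \<le> f ys" if "set ys \<subseteq> D \<times> UNIV" for ys using f_nonneg that by simp
    show "0 \<le> \<phi> u Z" if "u \<in> D \<times> UNIV" "finite Z" "Z \<subseteq> D \<times> UNIV" for u Z
      using \<phi>[THEN conjunct2, THEN conjunct1, THEN bspec, OF that(1)] that by simp
    show "\<phi> u Z = 1" if "u \<in> D \<times> UNIV" "finite Z" "Z \<subseteq> D \<times> UNIV" "\<not> u_clique R u Z" for u Z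
      using \<phi>[THEN conjunct2, THEN conjunct2, THEN conjunct1, THEN bspec, OF that(1)] that by simp
    show "f ys = f [] * (\<Prod>i<length ys. \<Prod>Z\<in>Pow (set (take i ys)). \<phi> (ys ! i) Z)"
      if "set ys \<subseteq> D \<times> UNIV" for ys
      using \<phi>[THEN conjunct2, THEN conjunct2, THEN conjunct2] that by blast
  qed
qed

end
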